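(* Let $M\subseteq\mathbb{R}[x,y]=\mathbb{R}[x_1,\dots,x_n,y_1,\dots,y_n]$ be a finitely generated hermitian module. If $X_M\subseteq\mathbb{C}^n$ contains an analytic disc, then $M$ does not satisfy Quillen's property (Q), i.e. there exists $f\in\mathbb{R}[x,y]$ with $f>0$ on $X_M$ and $f\notin M$.
   Context: $\mathbb{C}[z,\bar z]$ is the polynomial ring in $2n$ independent variables $z=(z_1,\dots,z_n)$, $\bar z=(\bar z_1,\dots,\bar z_n)$, with the conjugate-linear ring involution $*$ determined by $z_j^*=\bar z_j$. Its fixed ring is $\mathbb{R}[x,y]$, where $x_j=\frac12(z_j+\bar z_j)$, $y_j=\frac1{2i}(z_j-\bar z_j)$. For $f\in\mathbb{R}[x,y]$ and $a\in\mathbb{C}^n$, $f(a)\in\mathbb{R}$ is the value obtained by substituting $a$ for $z$ and $\bar a$ for $\bar z$. $\Sigma_h$ is the convex cone in $\mathbb{R}[x,y]$ generated by $\{pp^*: p\in\mathbb{C}[z]\}$. A hermitian module is a subset $M\subseteq\mathbb{R}[x,y]$ with $1\in M$, $M+M\subseteq M$ and $\Sigma_hM\subseteq M$; it is finitely generated if it is the smallest hermitian module containing some finite set $f_1,\dots,f_r$, i.e. $M=\Sigma_h+\Sigma_hf_1+\cdots+\Sigma_hf_r$. $X_M=\{a\in\mathbb{C}^n: g(a)\ge0\ \forall g\in M\}$. An analytic disc is the image of a nonconstant holomorphic map $\varphi:\mathbb{D}\to\mathbb{C}^n$, where $\mathbb{D}$ is the open unit disc in $\mathbb{C}$. *)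

theory Defs
  imports "HOL-Analysis.Analysis" "HOL-Library.Poly_Mapping"
begin

section \<open>Real vector space structure on finitely supported functions\<close>

text \<open>This instance makes the library's \<^term>\<open>convex_cone\<close> available on polynomials.\<close>

instantiation poly_mapping :: (type, real_vector) real_vector
begin

lift_definition scaleR_poly_mapping :: "real \<Rightarrow> ('a \<Rightarrow>\<^sub>0 'b) \<Rightarrow> 'a \<Rightarrow>\<^sub>0 'b"
  is "\<lambda>r f k. r *\<^sub>R f k"
  by (rule finite_subset[rotated]) auto

instance
  by standard (transfer; simp add: fun_eq_iff algebra_simps)+

end

section \<open>The ring $\mathbb{C}[z,\bar z]$ and its involution\<close>

datatype 'n var = Z 'n | Zbar 'n

type_synonym 'n cpoly = "('n var \<Rightarrow>\<^sub>0 nat) \<Rightarrow>\<^sub>0 complex"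

fun conj_var :: "'n var \<Rightarrow> 'n var" where
  "conj_var (Z j) = Zbar j"
| "conj_var (Zbar j) = Z j"

lemma conj_var_conj_var [simp]: "conj_var (conj_var v) = v"
  by (cases v) simp_all

lemma inj_conj_var [simp]: "inj conj_var"
  by (metis conj_var_conj_var injI)

definition conj_mon :: "('n var \<Rightarrow>\<^sub>0 nat) \<Rightarrow> ('n var \<Rightarrow>\<^sub>0 nat)" where
  "conj_mon m = Poly_Mapping.map_key conj_var m"

lemma conj_mon_conj_mon [simp]: "conj_mon (conj_mon m) = m"
  by (rule poly_mapping_eqI) (simp add: conj_mon_def map_key.rep_eq)

lemma inj_conj_mon [simp]: "inj conj_mon"
  by (metis conj_mon_conj_mon injI)

definition star :: "'n cpoly \<Rightarrow> 'n cpoly" where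
  "star f = Poly_Mapping.map cnj (Poly_Mapping.map_key conj_mon f)"

text \<open>The fixed ring of the involution, which is $\mathbb{R}[x,y]$ inside $\mathbb{C}[z,\bar z]$.\<close>

definition real_polys :: "'n cpoly set" where
  "real_polys = {f. star f = f}"

text \<open>The subring $\mathbb{C}[z]$ of polynomials not involving any $\bar z_j$.\<close>

definition holo_polys :: "'n cpoly set" where
  "holo_polys = {p. \<forall>m\<in>Poly_Mapping.keys p. \<forall>j. Poly_Mapping.lookup m (Zbar j) = 0}"

fun var_value :: "complex ^ 'n \<Rightarrow> 'n var \<Rightarrow> complex" where
  "var_value a (Z j) = a $ j"
| "var_value a (Zbar j) = cnj (a $ j)"

definition ceval :: "'n cpoly \<Rightarrow> complex ^ 'n \<Rightarrow> complex" where
  "ceval f a = (\<Sum>m\<in>Poly_Mapping.keys f. Poly_Mapping.lookup f m *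
     (\<Prod>v\<in>Poly_Mapping.keys m. var_value a v ^ Poly_Mapping.lookup m v))"

text \<open>For \<^term>\<open>f \<in> real_polys\<close> the value \<^term>\<open>ceval f a\<close> is already real; see
  \<open>ceval_real_polys\<close> below.\<close>

definition reval :: "'n cpoly \<Rightarrow> complex ^ 'n \<Rightarrow> real" where
  "reval f a = Re (ceval f a)"

section \<open>Hermitian modules\<close>

definition Sigma_h :: "'n cpoly set" where
  "Sigma_h = convex_cone hull {p * star p | p. p \<in> holo_polys}"

definition hermitian_module :: "'n cpoly set \<Rightarrow> bool" where
  "hermitian_module M \<longleftrightarrow> M \<subseteq> real_polys \<and> 1 \<in> M \<and>
     (\<forall>f\<in>M. \<forall>g\<in>M. f + g \<in> M) \<and> (\<forall>s\<in>Sigma_h. \<forall>f\<in>M. s * f \<in> M)"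

definition fg_hermitian_module :: "'n cpoly set \<Rightarrow> bool" where
  "fg_hermitian_module M \<longleftrightarrow> hermitian_module M \<and>
     (\<exists>F. finite F \<and> F \<subseteq> real_polys \<and> M = hermitian_module hull F)"

definition X_set :: "('n::finite) cpoly set \<Rightarrow> (complex ^ 'n) set" where
  "X_set M = {a. \<forall>g\<in>M. reval g a \<ge> 0}"

definition quillen_property :: "('n::finite) cpoly set \<Rightarrow> bool" where
  "quillen_property M \<longleftrightarrow> (\<forall>f\<in>real_polys. (\<forall>a\<in>X_set M. reval f a > 0) \<longrightarrow> f \<in> M)"

definition analytic_disc :: "(complex ^ ('n::finite)) set \<Rightarrow> bool" where
  "analytic_disc D \<longleftrightarrow> (\<exists>\<phi>. (\<forall>j. (\<lambda>t. \<phi> t $ j) holomorphic_on ball 0 1) \<and>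
     \<not> \<phi> constant_on ball 0 1 \<and> D = \<phi> ` ball 0 1)"

section \<open>Basic properties\<close>

lemma lookup_star: "Poly_Mapping.lookup (star f) m = cnj (Poly_Mapping.lookup f (conj_mon m))"
  by (simp add: star_def map.rep_eq map_key.rep_eq when_def)

lemma star_star [simp]: "star (star f) = f"
  by (rule poly_mapping_eqI) (simp add: lookup_star)

lemma star_add: "star (f + g) = star f + star g"
  by (rule poly_mapping_eqI) (simp add: lookup_star lookup_add)

lemma conj_mon_add: "conj_mon (k + l) = conj_mon k + conj_mon l"
  by (simp add: conj_mon_def map_key_plus)

lemma star_single: "star (Poly_Mapping.single m c) = Poly_Mapping.single (conj_mon m) (cnj c)"
proof (rule poly_mapping_eqI)
  fix k
  have "m = conj_mon k \<longleftrightarrow> conj_mon m = k"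
    by (metis conj_mon_conj_mon)
  then show "Poly_Mapping.lookup (star (Poly_Mapping.single m c)) k
      = Poly_Mapping.lookup (Poly_Mapping.single (conj_mon m) (cnj c)) k"
    by (simp add: lookup_star lookup_single when_def)
qed

lemma cpoly_induct [case_names single add]:
  fixes f :: "'n cpoly"
  assumes "\<And>m c. P (Poly_Mapping.single m c)" "\<And>f g. P f \<Longrightarrow> P g \<Longrightarrow> P (f + g)"
  shows "P f"
proof (induction f rule: update_induct)
  case const
  show ?case using assms(1)[of 0 0] by simp
next
  case (update f a b)
  have "Poly_Mapping.update a b f = f + Poly_Mapping.single a b"
    using update(1)
    by (intro poly_mapping_eqI)
      (auto simp: lookup_update lookup_add lookup_single when_def in_keys_iff)
  then show ?case using assms update by simp
qed

lemma star_mult: "star (f * g) = star f * star g"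
proof (induction f rule: cpoly_induct)
  case (single m c)
  show ?case
    by (induction g rule: cpoly_induct)
      (simp_all add: star_single mult_single conj_mon_add star_add distrib_left)
qed (simp add: star_add distrib_right)

lemma star_Z: "star (Poly_Mapping.single (Poly_Mapping.single (Z j) 1) 1)
    = Poly_Mapping.single (Poly_Mapping.single (Zbar j) 1) 1"
  using map_key_single[OF inj_conj_var, of "Zbar j" "Suc 0"]
  by (simp add: star_single conj_mon_def)

lemma ceval_superset:
  assumes "finite A" "Poly_Mapping.keys f \<subseteq> A"
  shows "ceval f a = (\<Sum>m\<in>A. Poly_Mapping.lookup f m *
     (\<Prod>v\<in>Poly_Mapping.keys m. var_value a v ^ Poly_Mapping.lookup m v))"
  unfolding ceval_def using assms by (intro sum.mono_neutral_left) (auto simp: in_keys_iff)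

lemma ceval_add: "ceval (f + g) a = ceval f a + ceval g a"
proof -
  let ?A = "Poly_Mapping.keys f \<union> Poly_Mapping.keys g"
  have "Poly_Mapping.keys (f + g) \<subseteq> ?A" by (rule keys_add)
  then show ?thesis
    using ceval_superset[of ?A "f + g" a] ceval_superset[of ?A f a] ceval_superset[of ?A g a]
    by (simp add: lookup_add distrib_right sum.distrib)
qed

lemma ceval_single: "ceval (Poly_Mapping.single m c) a =
    c * (\<Prod>v\<in>Poly_Mapping.keys m. var_value a v ^ Poly_Mapping.lookup m v)"
  by (simp add: ceval_def)

lemma mon_value_superset:
  assumes "finite A" "Poly_Mapping.keys m \<subseteq> A"
  shows "(\<Prod>v\<in>Poly_Mapping.keys m. var_value a v ^ Poly_Mapping.lookup m v)
    = (\<Prod>v\<in>A. var_value a v ^ Poly_Mapping.lookup m v)"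
  using assms by (intro prod.mono_neutral_left) (auto simp: in_keys_iff)

lemma mon_value_add:
  "(\<Prod>v\<in>Poly_Mapping.keys (k + l). var_value a v ^ Poly_Mapping.lookup (k + l) v)
    = (\<Prod>v\<in>Poly_Mapping.keys k. var_value a v ^ Poly_Mapping.lookup k v)
    * (\<Prod>v\<in>Poly_Mapping.keys l. var_value a v ^ Poly_Mapping.lookup l v)"
proof -
  let ?A = "Poly_Mapping.keys k \<union> Poly_Mapping.keys l"
  have "Poly_Mapping.keys (k + l) \<subseteq> ?A" by (rule keys_add)
  then show ?thesis
    using mon_value_superset[of ?A "k + l" a] mon_value_superset[of ?A k a]
      mon_value_superset[of ?A l a]
    by (simp add: lookup_add power_add prod.distrib)
qed

lemma ceval_mult: "ceval (f * g) a = ceval f a * ceval g a"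
proof (induction f rule: cpoly_induct)
  case (single m c)
  show ?case
    by (induction g rule: cpoly_induct)
      (simp_all add: ceval_single mult_single mon_value_add ceval_add distrib_left)
qed (simp add: ceval_add distrib_right)

lemma mon_value_conj_mon:
  "(\<Prod>v\<in>Poly_Mapping.keys (conj_mon m). var_value a v ^ Poly_Mapping.lookup (conj_mon m) v)
    = cnj (\<Prod>v\<in>Poly_Mapping.keys m. var_value a v ^ Poly_Mapping.lookup m v)"
proof -
  have val: "var_value a (conj_var v) = cnj (var_value a v)" for v
    by (cases v) simp_all
  have "Poly_Mapping.keys (conj_mon m) = conj_var -` Poly_Mapping.keys m"
    by (simp add: conj_mon_def keys_map_key)
  also have "\<dots> = conj_var ` Poly_Mapping.keys m"
    by (auto simp: image_iff) (metis conj_var_conj_var)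
  finally have keys: "Poly_Mapping.keys (conj_mon m) = conj_var ` Poly_Mapping.keys m" .
  show ?thesis
    unfolding keys
    by (subst prod.reindex) (auto simp: val conj_mon_def map_key.rep_eq inj_on_subset[OF inj_conj_var])
qed

lemma ceval_star: "ceval (star f) a = cnj (ceval f a)"
  by (induction f rule: cpoly_induct)
    (simp_all add: star_single ceval_single mon_value_conj_mon star_add ceval_add)

lemma ceval_real_polys: "f \<in> real_polys \<Longrightarrow> ceval f a = of_real (reval f a)"
  by (metis (mono_tags) ceval_star mem_Collect_eq real_polys_def reval_def Reals_cnj_iff of_real_Re)

lemma star_scaleR: "star (r *\<^sub>R f) = r *\<^sub>R star f"
  by (rule poly_mapping_eqI) (simp add: lookup_star scaleR_poly_mapping.rep_eq)

lemma Sigma_h_subset: "Sigma_h \<subseteq> real_polys"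
  unfolding Sigma_h_def
proof (rule hull_minimal)
  show "{p * star p |p. p \<in> holo_polys} \<subseteq> real_polys"
    by (auto simp: real_polys_def star_mult mult.commute)
  have "star 0 = 0"
    by (rule poly_mapping_eqI) (simp add: lookup_star)
  then show "convex_cone real_polys"
    by (simp add: convex_cone_iff real_polys_def star_add star_scaleR)
qed

lemma hermitian_module_real_polys: "hermitian_module real_polys"
proof -
  have "star 1 = 1"
    by (metis mult.right_neutral mult.commute star_mult star_star)
  then show ?thesis
    using Sigma_h_subset by (auto simp: hermitian_module_def real_polys_def star_add star_mult)
qed

lemma hermitian_module_hull:
  assumes "F \<subseteq> real_polys"
  shows "hermitian_module (hermitian_module hull F)"
proof -
  have "hermitian_module hull F \<subseteq> real_polys"
    using assms hermitian_module_real_polys by (rule hull_minimal)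
  then show ?thesis
    unfolding hermitian_module_def hull_def by blast
qed

end

theory Submission
  imports Defs "HOL-Complex_Analysis.Cauchy_Integral_Formula"
begin

text \<open>Let \<open>\<phi>\<close> parametrize the disc, choose \<open>t\<close> and \<open>j\<close> with \<open>\<phi>\<^sub>j'(t) \<noteq> 0\<close>, and for small \<open>\<rho>\<close> let \<open>L(g)\<close> be
  the mean of \<open>g \<circ> \<phi>\<close> over the circle of radius \<open>\<rho>\<close> about \<open>t\<close>, minus \<open>g(\<phi>(t))/2\<close>. A generator
  \<open>F\<close> of \<open>M\<close> is nonnegative on the disc, so \<open>F \<circ> \<phi> \<ge> F(\<phi>(t))/2\<close> on the circle: by continuity if
  \<open>F(\<phi>(t)) > 0\<close>, trivially if \<open>F(\<phi>(t)) = 0\<close>. With the sub-mean value property of \<open>|p \<circ> \<phi>|^2\<close>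
  this gives \<open>L(p p* F) \<ge> 0\<close> for holomorphic \<open>p\<close>, hence \<open>L \<ge> 0\<close> on \<open>M\<close>. For
  \<open>r = |\<phi>\<^sub>j'(t)|^2 \<rho>^2\<close> the strictly positive polynomial
  \<open>(|z\<^sub>j - \<phi>\<^sub>j(t)|^2 - r)^2 + r^2/4\<close> is at most \<open>r^2/2\<close> on the circle but \<open>5 r^2/4\<close> at its centre,
  so \<open>L\<close> is negative on it.\<close>

section \<open>Polynomials\<close>

lemma conj_mon_zero [simp]: "conj_mon 0 = 0"
  by (rule poly_mapping_eqI) (simp add: conj_mon_def map_key.rep_eq)

lemma ceval_const [simp]: "ceval (Poly_Mapping.single 0 c) a = c"
  by (simp add: ceval_single)

lemma star_const [simp]: "star (Poly_Mapping.single 0 c) = Poly_Mapping.single 0 (cnj c)"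
  by (simp add: star_single)

lemma one_in_holo_polys: "1 \<in> holo_polys"
  by (simp add: holo_polys_def)

lemma star_one [simp]: "star 1 = 1"
  using star_const[of 1] by simp

lemma holo_polys_mult: "p \<in> holo_polys \<Longrightarrow> q \<in> holo_polys \<Longrightarrow> p * q \<in> holo_polys"
  using keys_mult[of p q] by (fastforce simp: holo_polys_def lookup_add)

lemma ceval_scaleR: "ceval (r *\<^sub>R f) a = r *\<^sub>R ceval f a"
proof -
  have "Poly_Mapping.keys (r *\<^sub>R f) \<subseteq> Poly_Mapping.keys f"
    by (auto simp: in_keys_iff scaleR_poly_mapping.rep_eq)
  then show ?thesis
    using ceval_superset[of "Poly_Mapping.keys f" "r *\<^sub>R f" a]
    by (simp add: ceval_def scaleR_poly_mapping.rep_eq scaleR_sum_right)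
qed

lemma reval_add: "reval (f + g) a = reval f a + reval g a"
  by (simp add: reval_def ceval_add)

lemma reval_scaleR: "reval (r *\<^sub>R f) a = r * reval f a"
  by (simp add: reval_def ceval_scaleR)

lemma reval_mult_star: "reval (p * star p * g) a = (cmod (ceval p a))\<^sup>2 * reval g a"
proof -
  have "ceval p a * cnj (ceval p a) = complex_of_real ((cmod (ceval p a))\<^sup>2)"
    by (simp only: complex_norm_square)
  then show ?thesis
    by (simp add: reval_def ceval_mult ceval_star del: of_real_power)
qed

lemma continuous_on_ceval_comp:
  assumes "\<And>j. continuous_on S (\<lambda>t. \<phi> t $ j)"
  shows "continuous_on S (\<lambda>t. ceval g (\<phi> t))"
proof -
  have "continuous_on S (\<lambda>t. var_value (\<phi> t) v)" for v
    by (cases v) (auto intro!: continuous_intros assms)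
  then show ?thesis
    unfolding ceval_def by (intro continuous_intros)
qed

lemma holomorphic_on_ceval_comp:
  assumes "\<And>j. (\<lambda>t. \<phi> t $ j) holomorphic_on S" "p \<in> holo_polys"
  shows "(\<lambda>t. ceval p (\<phi> t)) holomorphic_on S"
proof -
  \<comment> \<open>Only variables that occur in \<open>p\<close> matter: membership in
    \<open>holo_polys\<close> excludes \<open>Zbar j\<close>, whose value would be
    antiholomorphic.\<close>
  have "(\<lambda>t. var_value (\<phi> t) v) holomorphic_on S"
    if "m \<in> Poly_Mapping.keys p" "v \<in> Poly_Mapping.keys m" for m v
    using that assms by (cases v) (auto simp: holo_polys_def in_keys_iff)
  then show ?thesis
    unfolding ceval_def by (intro holomorphic_intros)
qed

section \<open>Circle means\<close>

text \<open>\<open>circlepath\<close> runs once around the circle at constant speed over the unit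
  interval, so no normalizing factor appears.\<close>

definition circle_mean :: "complex \<Rightarrow> real \<Rightarrow> (complex \<Rightarrow> real) \<Rightarrow> real" where
  "circle_mean t \<rho> u = integral {0..1} (\<lambda>x. u (circlepath t \<rho> x))"

lemma integrable_circlepath:
  fixes u :: "complex \<Rightarrow> 'a::banach"
  assumes "continuous_on (sphere t \<rho>) u" "0 \<le> \<rho>"
  shows "(\<lambda>x. u (circlepath t \<rho> x)) integrable_on {0..1}"
proof (rule integrable_continuous_interval)
  show "continuous_on {0..1} (\<lambda>x. u (circlepath t \<rho> x))"
    using assms path_image_circlepath[of t \<rho>] path_circlepath[of t \<rho>]
    by (intro continuous_on_compose2[OF assms(1)]) (auto simp: path_def path_image_def)
qed

lemma circle_mean_mono:
  assumes "continuous_on (sphere t \<rho>) u" "continuous_on (sphere t \<rho>) v" "0 \<le> \<rho>"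
    and "\<And>s. s \<in> sphere t \<rho> \<Longrightarrow> u s \<le> v s"
  shows "circle_mean t \<rho> u \<le> circle_mean t \<rho> v"
  unfolding circle_mean_def
proof (intro integral_le integrable_circlepath assms(1-3))
  fix x :: real
  assume "x \<in> {0..1}"
  then have "circlepath t \<rho> x \<in> sphere t \<rho>"
    using path_image_circlepath[of t \<rho>] assms(3) unfolding path_image_def by auto
  then show "u (circlepath t \<rho> x) \<le> v (circlepath t \<rho> x)"
    by (rule assms(4))
qed

text \<open>Cauchy's formula is applied to the square of \<open>f\<close> instead of
  \<open>f\<close>: it writes \<open>(f t)\<^sup>2\<close> as a circle mean, and the triangle
  inequality for integrals finishes without Cauchy-Schwarz.\<close>

lemma norm_sq_le_circle_mean:
  assumes "f holomorphic_on cball t \<rho>" "0 < \<rho>"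
  shows "(cmod (f t))\<^sup>2 \<le> circle_mean t \<rho> (\<lambda>s. (cmod (f s))\<^sup>2)"
proof -
  let ?g = "\<lambda>s. (f s)\<^sup>2"
  have hol: "?g holomorphic_on cball t \<rho>"
    by (intro holomorphic_intros assms)
  have "((\<lambda>s. ?g s / (s - t)) has_contour_integral 2 * of_real pi * \<i> * ?g t) (circlepath t \<rho>)"
    using Cauchy_integral_circlepath_simple[OF hol, of t] assms by simp
  then have "((\<lambda>x. ?g (circlepath t \<rho> x) / (circlepath t \<rho> x - t) *
      vector_derivative (circlepath t \<rho>) (at x within {0..1}))
      has_integral 2 * of_real pi * \<i> * ?g t) {0..1}"
    by (simp add: has_contour_integral_def)
  \<comment> \<open>The derivative of the parametrization is \<open>2 * of_real pi * \<i>\<close>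
    times \<open>circlepath t \<rho> x - t\<close>, which cancels the Cauchy kernel.\<close>
  then have "((\<lambda>x. 2 * of_real pi * \<i> * ?g (circlepath t \<rho> x))
      has_integral 2 * of_real pi * \<i> * ?g t) {0..1}"
  proof (rule has_integral_eq[rotated])
    fix x :: real
    assume "x \<in> {0..1}"
    then have "vector_derivative (circlepath t \<rho>) (at x within {0..1})
        = 2 * of_real pi * \<i> * (circlepath t \<rho> x - t)"
      by (simp add: vector_derivative_circlepath01) (simp add: circlepath)
    moreover have "circlepath t \<rho> x - t \<noteq> 0"
      using assms(2) by (simp add: circlepath)
    ultimately show "?g (circlepath t \<rho> x) / (circlepath t \<rho> x - t) *
        vector_derivative (circlepath t \<rho>) (at x within {0..1})
      = 2 * of_real pi * \<i> * ?g (circlepath t \<rho> x)"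
      by simp
  qed
  then have *: "((\<lambda>x. ?g (circlepath t \<rho> x)) has_integral ?g t) {0..1}"
    using has_integral_mult_right[of "\<lambda>x. 2 * of_real pi * \<i> * ?g (circlepath t \<rho> x)"
        "2 * of_real pi * \<i> * ?g t" "{0..1}" "1 / (2 * of_real pi * \<i>)"]
    by simp
  have cont: "continuous_on (sphere t \<rho>) f"
    using holomorphic_on_imp_continuous_on[OF assms(1)] by (rule continuous_on_subset) auto
  have "norm (integral {0..1} (\<lambda>x. ?g (circlepath t \<rho> x)))
      \<le> integral {0..1} (\<lambda>x. (cmod (f (circlepath t \<rho> x)))\<^sup>2)"
    using assms(2) *
    by (intro integral_norm_bound_integral integrable_circlepath[of t \<rho> "\<lambda>s. (cmod (f s))\<^sup>2"])
      (auto intro!: continuous_intros cont simp: norm_power)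
  then show ?thesis
    using integral_unique[OF *] by (simp add: circle_mean_def norm_power)
qed

section \<open>The separating functional\<close>

text \<open>The weight 1/2 leaves room on both sides: below 1, so that continuity bounds generators
  from below on small circles; above 2/5, so that a polynomial with mean at most
  \<open>r\<^sup>2 / 2\<close> and centre value \<open>5 * r\<^sup>2 / 4\<close> gets a negative
  value.\<close>

definition disc_functional ::
    "(complex \<Rightarrow> complex ^ 'n) \<Rightarrow> complex \<Rightarrow> real \<Rightarrow> ('n::finite) cpoly \<Rightarrow> real" where
  "disc_functional \<phi> t \<rho> g = circle_mean t \<rho> (\<lambda>s. reval g (\<phi> s)) - reval g (\<phi> t) / 2"

context
  fixes \<phi> :: "complex \<Rightarrow> complex ^ 'n::finite" and t :: complex and \<rho> :: real
  assumes hol: "\<And>j. (\<lambda>s. \<phi> s $ j) holomorphic_on cball t \<rho>" and \<rho>: "0 < \<rho>"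
begin

lemma continuous_on_reval_comp: "continuous_on (sphere t \<rho>) (\<lambda>s. reval g (\<phi> s))"
proof -
  have "continuous_on (sphere t \<rho>) (\<lambda>s. \<phi> s $ j)" for j
    using holomorphic_on_imp_continuous_on[OF hol[of j]] by (rule continuous_on_subset) auto
  then show ?thesis
    unfolding reval_def by (intro continuous_on_Re continuous_on_ceval_comp)
qed

lemma disc_functional_add:
  "disc_functional \<phi> t \<rho> (f + g) = disc_functional \<phi> t \<rho> f + disc_functional \<phi> t \<rho> g"
  using integral_add[OF integrable_circlepath integrable_circlepath,
      OF continuous_on_reval_comp _ continuous_on_reval_comp, of f g] \<rho>
  by (simp add: disc_functional_def circle_mean_def reval_add add_divide_distrib)

lemma disc_functional_scaleR:
  "disc_functional \<phi> t \<rho> (r *\<^sub>R f) = r * disc_functional \<phi> t \<rho> f"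
  by (simp add: disc_functional_def circle_mean_def reval_scaleR right_diff_distrib)

text \<open>The squared modulus of \<open>p\<close> along the disc has the sub-mean value property,
  while \<open>F\<close> need not have it; so \<open>F\<close> is first frozen at half its centre
  value and then replaced by its larger values on the circle.\<close>

lemma disc_functional_mult_star_nonneg:
  assumes "p \<in> holo_polys" "0 \<le> reval F (\<phi> t)"
    and "\<And>s. s \<in> sphere t \<rho> \<Longrightarrow> reval F (\<phi> t) / 2 \<le> reval F (\<phi> s)"
  shows "0 \<le> disc_functional \<phi> t \<rho> (p * star p * F)"
proof -
  let ?P = "\<lambda>s. ceval p (\<phi> s)"
  have P: "?P holomorphic_on cball t \<rho>"
    by (intro holomorphic_on_ceval_comp hol assms)
  have cont: "continuous_on (sphere t \<rho>) ?P"
    using holomorphic_on_imp_continuous_on[OF P] by (rule continuous_on_subset) auto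
  have "reval (p * star p * F) (\<phi> t) / 2 = reval F (\<phi> t) / 2 * (cmod (?P t))\<^sup>2"
    by (simp add: reval_mult_star)
  also have "\<dots> \<le> reval F (\<phi> t) / 2 * circle_mean t \<rho> (\<lambda>s. (cmod (?P s))\<^sup>2)"
    using norm_sq_le_circle_mean[OF P \<rho>] assms by (intro mult_left_mono) auto
  also have "\<dots> = circle_mean t \<rho> (\<lambda>s. reval F (\<phi> t) / 2 * (cmod (?P s))\<^sup>2)"
    by (simp add: circle_mean_def)
  also have "\<dots> \<le> circle_mean t \<rho> (\<lambda>s. reval (p * star p * F) (\<phi> s))"
  proof (rule circle_mean_mono)
    show "reval F (\<phi> t) / 2 * (cmod (?P s))\<^sup>2 \<le> reval (p * star p * F) (\<phi> s)"
      if "s \<in> sphere t \<rho>" for s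
      using mult_right_mono[OF assms(3)[OF that], of "(cmod (?P s))\<^sup>2"]
      unfolding reval_mult_star by (simp add: mult.commute)
  qed (use \<rho> in \<open>auto intro!: continuous_intros cont continuous_on_reval_comp\<close>)
  finally show ?thesis
    by (simp add: disc_functional_def)
qed

text \<open>Nonnegativity of the functional is not preserved by multiplication with \<^term>\<open>Sigma_h\<close>, so
  the module to which minimality of the hull is applied has all multipliers \<open>p * star p\<close> built in.\<close>

lemma disc_functional_hull_nonneg:
  assumes F: "F \<subseteq> real_polys" "\<And>f. f \<in> F \<Longrightarrow> 0 \<le> reval f (\<phi> t)"
    "\<And>f s. f \<in> F \<Longrightarrow> s \<in> sphere t \<rho> \<Longrightarrow> reval f (\<phi> t) / 2 \<le> reval f (\<phi> s)"
    and g: "g \<in> hermitian_module hull F"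
  shows "0 \<le> disc_functional \<phi> t \<rho> g"
proof -
  let ?L = "disc_functional \<phi> t \<rho>"
  define N where "N = {g \<in> real_polys. \<forall>p\<in>holo_polys. 0 \<le> ?L (p * star p * g)}"
  have "1 \<in> N"
  proof -
    have "reval 1 a = 1" for a :: "complex ^ 'n"
      using ceval_const[of 1 a] by (simp add: reval_def)
    then show ?thesis
      using disc_functional_mult_star_nonneg[of _ 1] by (auto simp: N_def real_polys_def)
  qed
  moreover have "s * h \<in> N" if s: "s \<in> Sigma_h" and h: "h \<in> N" for s h
  proof -
    have "0 \<le> ?L (p * star p * (s * h))" if p: "p \<in> holo_polys" for p
    proof -
      \<comment> \<open>With \<open>p\<close> and \<open>h\<close> fixed, the admissible multipliers
        form a convex cone, so it suffices to test the generators \<open>q * star q\<close>; these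
        merge with \<open>p * star p\<close> into the multiplier of \<open>p * q\<close>.\<close>
      let ?C = "{s. 0 \<le> ?L (p * star p * (s * h))}"
      have scale: "p * star p * (c *\<^sub>R u * h) = c *\<^sub>R (p * star p * (u * h))" for c u
      proof -
        \<comment> \<open>Real scaling as multiplication by a constant polynomial moves through the
          product by commutativity.\<close>
        have "c *\<^sub>R v = Poly_Mapping.single 0 (complex_of_real c) * v" for v :: "'n cpoly"
        proof (rule poly_mapping_eqI)
          fix k
          show "Poly_Mapping.lookup (c *\<^sub>R v) k
              = Poly_Mapping.lookup (Poly_Mapping.single 0 (complex_of_real c) * v) k"
            by (induction v rule: cpoly_induct)
              (auto simp: scaleR_poly_mapping.rep_eq mult_single lookup_single when_def
                distrib_left lookup_add scaleR_conv_of_real)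
        qed
        then show ?thesis by (simp add: mult_ac)
      qed
      have zero: "?L 0 = 0"
        using disc_functional_scaleR[of 0 0] by simp
      have "convex_cone ?C"
        by (auto simp: convex_cone_iff scale disc_functional_scaleR distrib_left distrib_right
            disc_functional_add zero)
      moreover have "q * star q \<in> ?C" if q: "q \<in> holo_polys" for q
      proof -
        have "p * star p * (q * star q * h) = (p * q) * star (p * q) * h"
          by (simp add: star_mult mult_ac)
        then show ?thesis
          using h holo_polys_mult[OF p q] by (simp add: N_def)
      qed
      ultimately have "Sigma_h \<subseteq> ?C"
        unfolding Sigma_h_def by (intro hull_minimal) auto
      then show ?thesis using s by auto
    qed
    then show ?thesis
      using s h Sigma_h_subset by (auto simp: N_def real_polys_def star_mult)
  qed
  ultimately have "hermitian_module N"
    by (auto simp: hermitian_module_def N_def real_polys_def star_add distrib_left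
        disc_functional_add)
  moreover have "F \<subseteq> N"
    using F disc_functional_mult_star_nonneg by (auto simp: N_def)
  ultimately have "hermitian_module hull F \<subseteq> N"
    by (intro hull_minimal)
  \<comment> \<open>The multiplier \<open>p = 1\<close> recovers the functional on \<open>g\<close>
    itself.\<close>
  then have "0 \<le> ?L (1 * star 1 * g)"
    using g one_in_holo_polys unfolding N_def by blast
  then show ?thesis by simp
qed

end

section \<open>The positive polynomial outside the module\<close>

text \<open>The square is small near the ring where the squared distance of the \<open>j\<close>-th
  coordinate from \<open>a\<close> equals \<open>r\<close>; for \<open>r > 0\<close> the added
  constant makes the polynomial positive on the whole space.\<close>

definition ring_poly :: "'n \<Rightarrow> complex \<Rightarrow> real \<Rightarrow> 'n cpoly" where
  "ring_poly j a r =
    (let w = Poly_Mapping.single (Poly_Mapping.single (Z j) 1) 1 + Poly_Mapping.single 0 (- a);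
         q = w * star w + Poly_Mapping.single 0 (of_real (- r))
     in q * q + Poly_Mapping.single 0 (of_real (r\<^sup>2 / 4)))"

lemma ring_poly_real: "ring_poly j a r \<in> real_polys"
  by (simp add: ring_poly_def Let_def real_polys_def star_add star_mult mult.commute)

lemma reval_ring_poly: "reval (ring_poly j a r) b = ((cmod (b $ j - a))\<^sup>2 - r)\<^sup>2 + r\<^sup>2 / 4"
proof -
  have "ceval (ring_poly j a r) b
      = ((b $ j - a) * cnj (b $ j - a) - of_real r)\<^sup>2 + of_real (r\<^sup>2 / 4)"
    by (simp add: ring_poly_def Let_def ceval_add ceval_mult ceval_star ceval_single power2_eq_square)
  also have "\<dots> = of_real (((cmod (b $ j - a))\<^sup>2 - r)\<^sup>2 + r\<^sup>2 / 4)"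
    by (simp only: complex_norm_square[symmetric] of_real_add of_real_diff of_real_power)
  finally show ?thesis
    by (simp add: reval_def del: of_real_add of_real_diff of_real_power)
qed

text \<open>A punctured neighbourhood contains all small spheres about its centre. Phrasing this as
  a filter on radii lets several local conditions share one radius.\<close>

lemma eventually_sphere:
  fixes a :: "'a::metric_space"
  assumes "eventually P (at a)"
  shows "\<forall>\<^sub>F \<rho> in at_right 0. \<forall>s\<in>sphere a \<rho>. P s"
proof -
  obtain d where "d > 0" "\<And>s. s \<noteq> a \<Longrightarrow> dist s a < d \<Longrightarrow> P s"
    using assms by (auto simp: eventually_at)
  then show ?thesis
    by (intro eventually_at_rightI[of 0 d]) (auto simp: dist_commute)
qed

lemma nonconstant_imp_deriv_nonzero:
  assumes "f holomorphic_on S" "open S" "convex S" "\<not> f constant_on S"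
  shows "\<exists>t\<in>S. deriv f t \<noteq> 0"
proof (rule ccontr)
  assume "\<not> ?thesis"
  then have "\<And>t. t \<in> S \<Longrightarrow> (f has_field_derivative 0) (at t within S)"
    using assms(1,2) by (metis holomorphic_derivI)
  then have "\<exists>c. \<forall>t\<in>S. f t = c"
    using has_field_derivative_zero_constant[OF assms(3)] by blast
  then show False
    using assms(4) by (auto simp: constant_on_def)
qed

theorem corollary6p22:
  fixes M :: "('n::finite) cpoly set"
  assumes "fg_hermitian_module M"
    and "\<exists>D. analytic_disc D \<and> D \<subseteq> X_set M"
  shows "\<not> quillen_property M"
proof
  assume Q: "quillen_property M"
  obtain F where F: "finite F" "F \<subseteq> real_polys" "M = hermitian_module hull F"
    using assms(1) by (auto simp: fg_hermitian_module_def)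
  obtain \<phi> where hol: "\<And>j. (\<lambda>t. \<phi> t $ j) holomorphic_on ball 0 1"
    and nc: "\<not> \<phi> constant_on ball 0 1" and X: "\<phi> ` ball 0 1 \<subseteq> X_set M"
    using assms(2) by (auto simp: analytic_disc_def)
  obtain j where "\<not> (\<lambda>t. \<phi> t $ j) constant_on ball 0 1"
    using nc unfolding constant_on_def vec_eq_iff by (metis vec_lambda_beta)
  then obtain t where t: "t \<in> ball 0 1" "deriv (\<lambda>t. \<phi> t $ j) t \<noteq> 0"
    using nonconstant_imp_deriv_nonzero[OF hol, of j] by auto
  \<comment> \<open>On a small circle of radius \<open>\<rho>\<close> about \<open>t\<close>, the
    squared distance of \<open>\<phi> s $ j\<close> from \<open>\<phi> t $ j\<close> is close to
    \<open>d * \<rho>\<^sup>2\<close>.\<close>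
  define d where "d = (cmod (deriv (\<lambda>t. \<phi> t $ j) t))\<^sup>2"
  have d: "d > 0" using t by (simp add: d_def)
  have F_nonneg: "0 \<le> reval f (\<phi> s)" if "f \<in> F" "s \<in> ball 0 1" for f s
  proof -
    have "f \<in> M" using that(1) F(3) by (simp add: hull_inc)
    moreover have "\<phi> s \<in> X_set M" using that(2) X by blast
    ultimately show ?thesis by (simp add: X_set_def)
  qed

  have "\<forall>\<^sub>F s in at t. reval f (\<phi> t) / 2 \<le> reval f (\<phi> s)" if f: "f \<in> F" for f
  proof (cases "reval f (\<phi> t) = 0")
    case True
    have "\<forall>\<^sub>F s in at t. s \<in> ball 0 1"
      using t(1) by (intro eventually_at_in_open') auto
    then show ?thesis
      by (rule eventually_mono) (use True F_nonneg[OF f] in simp)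
  next
    case False
    have "continuous_on (ball 0 1) (\<lambda>s. reval f (\<phi> s))"
      unfolding reval_def
      by (intro continuous_intros continuous_on_ceval_comp holomorphic_on_imp_continuous_on hol)
    then have "((\<lambda>s. reval f (\<phi> s)) \<longlongrightarrow> reval f (\<phi> t)) (at t)"
      using t by (simp add: continuous_on_eq_continuous_at isCont_def)
    moreover have "reval f (\<phi> t) / 2 < reval f (\<phi> t)"
      using False F_nonneg[OF f t(1)] by simp
    ultimately show ?thesis
      using order_tendstoD(1) by (fastforce elim: eventually_mono)
  qed
  \<comment> \<open>Finite generation enters here: finitely many neighbourhoods of \<open>t\<close>
    intersect in one that serves every generator.\<close>
  then have ev_F: "\<forall>\<^sub>F \<rho> in at_right 0. \<forall>s\<in>sphere t \<rho>. \<forall>f\<in>F. reval f (\<phi> t) / 2 \<le> reval f (\<phi> s)"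
    using F(1) by (intro eventually_sphere) (simp add: eventually_ball_finite)

  have "((\<lambda>s. (\<phi> s $ j - \<phi> t $ j) / (s - t)) \<longlongrightarrow> deriv (\<lambda>t. \<phi> t $ j) t) (at t)"
    using holomorphic_derivI[OF hol _ t(1), of j] by (simp add: has_field_derivative_iff)
  then have "((\<lambda>s. (cmod ((\<phi> s $ j - \<phi> t $ j) / (s - t)))\<^sup>2) \<longlongrightarrow> d) (at t)"
    unfolding d_def by (intro tendsto_intros)
  \<comment> \<open>The tolerance \<open>d / 2\<close> becomes \<open>r / 2\<close> after scaling by
    \<open>\<rho>\<^sup>2\<close>; its square \<open>r\<^sup>2 / 4\<close> plus the constant of
    \<open>ring_poly\<close> is the bound \<open>r\<^sup>2 / 2\<close> on the circle.\<close>
  then have "\<forall>\<^sub>F s in at t. dist ((cmod ((\<phi> s $ j - \<phi> t $ j) / (s - t)))\<^sup>2) d < d / 2"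
    using d by (intro tendstoD) auto
  then have ev_d: "\<forall>\<^sub>F \<rho> in at_right 0. \<forall>s\<in>sphere t \<rho>.
      dist ((cmod ((\<phi> s $ j - \<phi> t $ j) / (s - t)))\<^sup>2) d < d / 2"
    by (rule eventually_sphere)

  obtain e where e: "e > 0" "cball t e \<subseteq> ball 0 1"
    using t(1) open_ball unfolding open_contains_cball by blast
  have "\<forall>\<^sub>F \<rho> in at_right (0::real). \<rho> \<in> {0<..<e}"
    using e(1) by (rule eventually_at_right_real)
  then obtain \<rho> where "\<rho> \<in> {0<..<e}"
    and \<rho>_F: "\<forall>s\<in>sphere t \<rho>. \<forall>f\<in>F. reval f (\<phi> t) / 2 \<le> reval f (\<phi> s)"
    and \<rho>_d: "\<forall>s\<in>sphere t \<rho>. dist ((cmod ((\<phi> s $ j - \<phi> t $ j) / (s - t)))\<^sup>2) d < d / 2"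
    using eventually_happens'[OF trivial_limit_at_right_real eventually_conj[OF _ eventually_conj[OF ev_F ev_d]]]
    by blast
  then have \<rho>: "0 < \<rho>" "\<rho> < e" by auto
  have hol\<rho>: "(\<lambda>s. \<phi> s $ i) holomorphic_on cball t \<rho>" for i
    using hol by (rule holomorphic_on_subset) (use e \<rho> in \<open>auto simp: subset_iff\<close>)

  define r where "r = d * \<rho>\<^sup>2"
  have r: "r > 0" using d \<rho> by (simp add: r_def)
  let ?h = "ring_poly j (\<phi> t $ j) r"
  have "reval ?h b > 0" for b
    using r by (simp add: reval_ring_poly add_nonneg_pos)
  then have h: "?h \<in> hermitian_module hull F"
    unfolding F(3)[symmetric]
    using Q by (simp add: quillen_property_def ring_poly_real)
  have "0 \<le> disc_functional \<phi> t \<rho> ?h"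
    using disc_functional_hull_nonneg[OF hol\<rho> \<rho>(1) F(2) F_nonneg[OF _ t(1)] _ h] \<rho>_F by simp
  moreover have "circle_mean t \<rho> (\<lambda>s. reval ?h (\<phi> s)) \<le> circle_mean t \<rho> (\<lambda>s. r\<^sup>2 / 2)"
  proof (rule circle_mean_mono)
    fix s assume s: "s \<in> sphere t \<rho>"
    then have "cmod (s - t) = \<rho>" by (simp add: dist_norm norm_minus_commute)
    then have "\<bar>(cmod (\<phi> s $ j - \<phi> t $ j))\<^sup>2 / \<rho>\<^sup>2 - d\<bar> < d / 2"
      using bspec[OF \<rho>_d s] by (simp add: dist_real_def norm_divide power_divide)
    then have "\<bar>(cmod (\<phi> s $ j - \<phi> t $ j))\<^sup>2 / \<rho>\<^sup>2 - d\<bar> * \<rho>\<^sup>2 \<le> d / 2 * \<rho>\<^sup>2"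
      by (intro mult_right_mono) auto
    also have "\<bar>(cmod (\<phi> s $ j - \<phi> t $ j))\<^sup>2 / \<rho>\<^sup>2 - d\<bar> * \<rho>\<^sup>2
        = \<bar>((cmod (\<phi> s $ j - \<phi> t $ j))\<^sup>2 / \<rho>\<^sup>2 - d) * \<rho>\<^sup>2\<bar>"
      by (simp add: abs_mult)
    also have "((cmod (\<phi> s $ j - \<phi> t $ j))\<^sup>2 / \<rho>\<^sup>2 - d) * \<rho>\<^sup>2
        = (cmod (\<phi> s $ j - \<phi> t $ j))\<^sup>2 - r"
      using \<rho> by (simp add: r_def field_simps)
    finally have "\<bar>(cmod (\<phi> s $ j - \<phi> t $ j))\<^sup>2 - r\<bar> \<le> r / 2"
      by (simp add: r_def)
    then have "((cmod (\<phi> s $ j - \<phi> t $ j))\<^sup>2 - r)\<^sup>2 \<le> (r / 2)\<^sup>2"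
      using r by (intro abs_le_square_iff[THEN iffD1]) simp
    then show "reval ?h (\<phi> s) \<le> r\<^sup>2 / 2"
      by (simp add: reval_ring_poly power_divide)
  next
    show "continuous_on (sphere t \<rho>) (\<lambda>s. reval ?h (\<phi> s))"
      by (rule continuous_on_reval_comp[OF hol\<rho> \<rho>(1)])
  qed (use \<rho> in simp_all)
  moreover have "reval ?h (\<phi> t) = r\<^sup>2 + r\<^sup>2 / 4"
    by (simp add: reval_ring_poly)
  moreover have "circle_mean t \<rho> (\<lambda>s. r\<^sup>2 / 2) = r\<^sup>2 / 2"
    by (simp add: circle_mean_def)
  \<comment> \<open>Half the centre value is \<open>5 * r\<^sup>2 / 8\<close>, so the functional is
    at most \<open>- r\<^sup>2 / 8\<close>.\<close>
  ultimately have "r\<^sup>2 \<le> 0"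
    unfolding disc_functional_def by linarith
  then show False using r by simp
qed

end
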